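(* Let $K\ge 1$ be an integer. Consider the multi-server job queueing system with $n$ servers and $K$ job classes under the First-Come-First-Served (FCFS) policy, with class arrival rates $\lambda_i^{(n)}$, service rates $\mu_i$ and server needs $m_i^{(n)}$, $1\le i\le K$. Let $m_{\max}^{(n)}=\max_{1\le i\le K} m_i^{(n)}$ and $\rho^{(n)}=\sum_{i=1}^K \frac{\lambda_i^{(n)} m_i^{(n)}}{n\mu_i}$, and assume that $\rho^{(n)}<1-\frac{m_{\max}^{(n)}}{n}$. Then the queueing probability $P_Q^{(n)}$ satisfies $$P_Q^{(n)}\le \frac{1}{1-\rho^{(n)}}\left(3K\sqrt{\frac{m_{\max}^{(n)}}{n}}+\frac{m_{\max}^{(n)}}{n}\right).$$ Consequently, for a sequence of such systems indexed by $n$ (with $K$ and the $\mu_i$ not depending on $n$), if $\frac{1}{1-\rho^{(n)}}\sqrt{\frac{m_{\max}^{(n)}}{n}}\to 0$ as $n\to\infty$, then $$\lim_{n\to\infty}P_Q^{(n)}=0.$$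
   Context: Multi-server job queueing model. There are $n$ identical servers and $K$ job classes. Jobs arrive according to a Poisson process of rate $\lambda^{(n)}>0$; each arrival is independently of class $i$ with probability $p_i^{(n)}>0$ ($\sum_i p_i^{(n)}=1$), so class $i$ jobs arrive as a Poisson process of rate $\lambda_i^{(n)}=\lambda^{(n)}p_i^{(n)}$. A class $i$ job has server need $m_i^{(n)}$, an integer with $1\le m_i^{(n)}\le n$: it occupies $m_i^{(n)}$ servers simultaneously for its whole service time. Service times are independent, independent of arrivals, and exponentially distributed with rate $\mu_i>0$ for class $i$. FCFS policy: arriving jobs join a single FCFS queue of infinite capacity. An arriving job enters service immediately if the queue is empty and the number of idle servers is at least its server need; otherwise it waits in the queue. Jobs enter service in arrival order: the head-of-queue job enters service as soon as the number of idle servers is at least its server need, and while it cannot enter service it blocks all jobs behind it. State: $\mathbf U^{(n)}(t)=(u_1(t),\dots,u_J(t))$ is the list of the classes of all jobs in the system (in queue plus in service) at time $t$, in arrival order. The state space is $\mathcal U=\{(u_1,\dots,u_J): J\in\{0,1,2,\dots\},\ u_j\in\{1,\dots,K\}\}$ (including the empty list). In state $u$, the jobs in service are those in the longest prefix $(u_1,\dots,u_k)$ with $\sum_{j=1}^k m_{u_j}^{(n)}\le n$; the remaining jobs are in the queue. Transitions: a class $i$ is appended at the end of the list at rate $\lambda_i^{(n)}$, and each job in service, of class $i$ say, is removed from the list at rate $\mu_i$. This is an irreducible continuous-time Markov chain; when $\rho^{(n)}<1-m_{\max}^{(n)}/n$ it is positive recurrent and so has a unique stationary distribution. Queueing probability: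 $P_Q^{(n)}$ is the steady-state probability that a job cannot enter service immediately upon arrival. Since arrivals are Poisson, this is the probability that, when the state is drawn from the stationary distribution and an arriving class $i$ is drawn independently with probability $p_i^{(n)}$, either the queue is nonempty or the number of idle servers is less than $m_i^{(n)}$. *)

theory Defs
  imports "HOL-Probability.Probability"
begin

text \<open>
  Multi-server jobs under First-Come-First-Served. The job classes are the elements of a finite
  type \<open>'k\<close>, so the number of classes is \<open>K = CARD('k) \<ge> 1\<close> and the state space is the set of all
  lists over \<open>'k\<close>. The class of an arriving job is distributed according to \<open>class_dist\<close>.
\<close>

record 'k msj =
  servers :: nat
  arrival_rate :: real
  class_dist :: "'k pmf"
  service_rate :: "'k \<Rightarrow> real"
  server_need :: "'k \<Rightarrow> nat"

definition msj_system :: "'k::finite msj \<Rightarrow> bool" where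
  "msj_system S \<longleftrightarrow>
     arrival_rate S > 0 \<and>
     (\<forall>i. pmf (class_dist S) i > 0) \<and>
     (\<forall>i. service_rate S i > 0) \<and>
     (\<forall>i. 1 \<le> server_need S i \<and> server_need S i \<le> servers S)"

definition class_rate :: "'k::finite msj \<Rightarrow> 'k \<Rightarrow> real" where
  "class_rate S i = arrival_rate S * pmf (class_dist S) i"

definition max_need :: "'k::finite msj \<Rightarrow> nat" where
  "max_need S = Max (range (server_need S))"

definition load :: "'k::finite msj \<Rightarrow> real" where
  "load S = (\<Sum>i\<in>UNIV. class_rate S i * real (server_need S i) /
                         (real (servers S) * service_rate S i))"

text \<open>
  A state lists the classes of all jobs in the system in arrival order; the jobs in service form the
  longest prefix whose total server need is at most the number of servers.
\<close>

definition num_in_service :: "'k::finite msj \<Rightarrow> 'k list \<Rightarrow> nat" where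
  "num_in_service S u =
     Max {k. k \<le> length u \<and> (\<Sum>j<k. server_need S (u ! j)) \<le> servers S}"

definition queue :: "'k::finite msj \<Rightarrow> 'k list \<Rightarrow> 'k list" where
  "queue S u = drop (num_in_service S u) u"

text \<open>The subtraction does not truncate, by the choice of \<^const>\<open>num_in_service\<close>.\<close>

definition idle_servers :: "'k::finite msj \<Rightarrow> 'k list \<Rightarrow> nat" where
  "idle_servers S u = servers S - (\<Sum>j<num_in_service S u. server_need S (u ! j))"

definition remove_job :: "nat \<Rightarrow> 'k list \<Rightarrow> 'k list" where
  "remove_job j u = take j u @ drop (Suc j) u"

text \<open>
  Departures of different jobs may lead to the same list; the sum over positions adds up their rates.
  No transition leads from a state to itself, since the length of the list changes.
\<close>

definition trans_rate :: "'k::finite msj \<Rightarrow> 'k list \<Rightarrow> 'k list \<Rightarrow> real" where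
  "trans_rate S u v =
     (\<Sum>i\<in>UNIV. if v = u @ [i] then class_rate S i else 0) +
     (\<Sum>j<num_in_service S u. if v = remove_job j u then service_rate S (u ! j) else 0)"

definition exit_rate :: "'k::finite msj \<Rightarrow> 'k list \<Rightarrow> real" where
  "exit_rate S u = (\<Sum>\<^sub>\<infinity>v. trans_rate S u v)"

definition generator :: "'k::finite msj \<Rightarrow> 'k list \<Rightarrow> 'k list \<Rightarrow> real" where
  "generator S u v = (if u = v then - exit_rate S u else trans_rate S u v)"

text \<open>
  The equation \<open>\<pi>Q = 0\<close> for a probability distribution \<open>\<pi>\<close>. The rates are bounded
  (at most \<open>servers S\<close> jobs are in service), so the chain is non-explosive.
\<close>

definition stationary_distribution :: "'k::finite msj \<Rightarrow> 'k list pmf \<Rightarrow> bool" where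
  "stationary_distribution S \<pi> \<longleftrightarrow>
     (\<forall>v. ((\<lambda>u. pmf \<pi> u * generator S u v) has_sum 0) UNIV)"

text \<open>The state and the class of the arriving job are drawn independently.\<close>

definition queueing_prob :: "'k::finite msj \<Rightarrow> 'k list pmf \<Rightarrow> real" where
  "queueing_prob S \<pi> =
     measure_pmf.prob (pair_pmf \<pi> (class_dist S))
       {(u, i). queue S u \<noteq> [] \<or> idle_servers S u < server_need S i}"

end

theory Submission imports Defs begin

text \<open>
  For a class \<open>i\<close> let \<open>N\<close> and \<open>Z\<close> be the numbers of its jobs in the system and in service, and
  \<open>r = \<lambda>\<^sub>i / \<mu>\<^sub>i\<close>. Stationarity applied to functions of \<open>N\<close> gives \<open>r E[h(N + 1)] = E[Z h(N)]\<close>, that is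
  \<open>E[(Z - r) h(N)] = r E[h(N + 1) - h(N)]\<close>, for every bounded \<open>h\<close>. Take for \<open>h\<close> the ramp that grows
  linearly from \<open>0\<close> to \<open>1\<close> on \<open>[r, r + \<surd>r]\<close>: the right-hand side is at most \<open>\<surd>r\<close>. On the other hand
  \<open>(Z - r) h(N) \<ge> Z - r - \<surd>r\<close> always, and \<open>(Z - r) h(N) \<ge> 0\<close> if the queue is empty, since then
  \<open>Z = N\<close>. Weighting with the server needs and summing over the classes bounds the probability that
  more than \<open>n - m\<^sub>m\<^sub>a\<^sub>x\<close> servers are busy, and an arriving job can only be delayed in that event.
  Each class contributes \<open>2 m\<^sub>i \<surd>r \<le> 2 \<surd>(m\<^sub>m\<^sub>a\<^sub>x n)\<close>, so that the factor \<open>3\<close> can be improved to \<open>2\<close>.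
\<close>

section \<open>Expectations and transition rates as unordered sums, the form in which stationarity
  is stated\<close>

lemma has_sum_pmf_times_bounded:
  fixes g :: "'a \<Rightarrow> real"
  assumes "\<And>u. \<bar>g u\<bar> \<le> C"
  shows "((\<lambda>u. pmf p u * g u) has_sum measure_pmf.expectation p g) UNIV"
proof -
  have "integrable (measure_pmf p) g"
    by (rule measure_pmf.integrable_const_bound[where B = C]) (auto simp: assms)
  then have "integrable (count_space UNIV) (\<lambda>u. pmf p u *\<^sub>R g u)"
    unfolding measure_pmf_eq_density by (subst (asm) integrable_density) auto
  then have abs: "Infinite_Set_Sum.abs_summable_on (\<lambda>u. pmf p u * g u) UNIV"
    by (simp add: Infinite_Set_Sum.abs_summable_on_def)
  then have "(\<lambda>u. pmf p u * g u) summable_on UNIV"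
    by (rule abs_summable_summable[OF iffD2[OF abs_summable_equivalent]])
  then show ?thesis
    unfolding pmf_expectation_eq_infsetsum infsetsum_infsum[OF abs] by (rule has_sum_infsum)
qed

lemma has_sum_sum_finite:
  fixes f :: "'i \<Rightarrow> 'a \<Rightarrow> real"
  assumes "finite I" "\<And>i. i \<in> I \<Longrightarrow> (f i has_sum s i) A"
  shows "((\<lambda>x. \<Sum>i\<in>I. f i x) has_sum (\<Sum>i\<in>I. s i)) A"
  using assms by (induction I rule: finite_induct) (auto intro!: has_sum_add)

text \<open>For fixed \<open>u\<close> each summand of the rate is supported on a single target
  \<open>v\<close>, so the sum over all states collapses to a finite one. Arbitrary \<open>f\<close>
  serves the generator; \<open>f = 1\<close> gives the exit rate.\<close>

lemma has_sum_trans_rate: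
  "((\<lambda>v. trans_rate S u v * f v) has_sum
     (\<Sum>i\<in>UNIV. class_rate S i * f (u @ [i])) +
     (\<Sum>j<num_in_service S u. service_rate S (u ! j) * f (remove_job j u))) UNIV"
proof -
  have *: "((\<lambda>v. (if v = w then c else 0) * f v) has_sum c * f w) UNIV" for w and c :: real
    by (rule has_sum_finite_neutralI[of "{w}"]) auto
  show ?thesis
    unfolding trans_rate_def distrib_right sum_distrib_right
    by (intro has_sum_add has_sum_sum_finite *) auto
qed

lemma exit_rate_eq:
  "exit_rate S u = (\<Sum>i\<in>UNIV. class_rate S i) + (\<Sum>j<num_in_service S u. service_rate S (u ! j))"
  using infsumI[OF has_sum_trans_rate[of S u "\<lambda>_. 1"]] by (simp add: exit_rate_def)

section \<open>Jobs in service and boundedness of the rates\<close>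

lemma
  shows num_in_service_le_length: "num_in_service S u \<le> length u"
    and num_in_service_fits: "(\<Sum>j<num_in_service S u. server_need S (u ! j)) \<le> servers S"
    and num_in_service_ge: "\<lbrakk>k \<le> length u; (\<Sum>j<k. server_need S (u ! j)) \<le> servers S\<rbrakk> \<Longrightarrow>
      k \<le> num_in_service S u"
proof -
  let ?K = "{k. k \<le> length u \<and> (\<Sum>j<k. server_need S (u ! j)) \<le> servers S}"
  have fin: "finite ?K" by simp
  have "0 \<in> ?K" by simp
  then have "Max ?K \<in> ?K" by (intro Max_in fin) blast
  then show "num_in_service S u \<le> length u"
    "(\<Sum>j<num_in_service S u. server_need S (u ! j)) \<le> servers S"
    unfolding num_in_service_def by simp_all
  show "k \<le> num_in_service S u"
    if "k \<le> length u" "(\<Sum>j<k. server_need S (u ! j)) \<le> servers S"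
    unfolding num_in_service_def using that fin by (intro Max_ge) auto
qed

lemma num_in_service_le_servers:
  assumes "msj_system S"
  shows "num_in_service S u \<le> servers S"
proof -
  have "(\<Sum>j<num_in_service S u. 1) \<le> (\<Sum>j<num_in_service S u. server_need S (u ! j))"
    by (rule sum_mono) (use assms in \<open>auto simp: msj_system_def\<close>)
  then show ?thesis using num_in_service_fits[of S u] by simp
qed

lemma class_rate_pos: "msj_system S \<Longrightarrow> class_rate S i > 0"
  by (simp add: msj_system_def class_rate_def)

lemma trans_rate_nonneg:
  assumes "msj_system S"
  shows "trans_rate S u v \<ge> 0"
  unfolding trans_rate_def using class_rate_pos[OF assms] assms
  by (intro add_nonneg_nonneg sum_nonneg) (auto simp: msj_system_def less_imp_le)

lemma length_remove_job: "j < length u \<Longrightarrow> length (remove_job j u) = length u - 1"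
  by (auto simp: remove_job_def)

lemma trans_rate_self: "trans_rate S u u = 0"
proof -
  have "u \<noteq> remove_job j u" if "j < num_in_service S u" for j
    using length_remove_job[of j u] num_in_service_le_length[of S u] that by force
  then show ?thesis by (auto simp: trans_rate_def intro!: sum.neutral)
qed

text \<open>Every job needs at least one server, so at most \<open>servers S\<close> jobs can
  depart; the sum of all service rates serves as a crude bound for each of them.\<close>

lemma exit_rate_bounded:
  assumes "msj_system S"
  obtains C where "\<And>u. \<bar>exit_rate S u\<bar> \<le> C"
proof
  fix u
  let ?M = "\<Sum>i\<in>UNIV. service_rate S i"
  have pos: "service_rate S i \<ge> 0" for i using assms by (simp add: msj_system_def less_imp_le)
  have le: "service_rate S i \<le> ?M" for i by (rule member_le_sum) (use pos in auto)
  have "(\<Sum>j<num_in_service S u. service_rate S (u ! j)) \<le> (\<Sum>j<num_in_service S u. ?M)"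
    by (rule sum_mono) (rule le)
  also have "\<dots> \<le> real (servers S) * ?M"
    using num_in_service_le_servers[OF assms, of u]
    by (simp add: mult_right_mono sum_nonneg pos)
  moreover have "(\<Sum>j<num_in_service S u. service_rate S (u ! j)) \<ge> 0"
    "(\<Sum>i\<in>UNIV. class_rate S i) \<ge> 0"
    using class_rate_pos[OF assms] by (auto intro!: sum_nonneg pos simp: less_imp_le)
  ultimately show "\<bar>exit_rate S u\<bar> \<le> (\<Sum>i\<in>UNIV. class_rate S i) + real (servers S) * ?M"
    unfolding exit_rate_eq by linarith
qed

section \<open>The generator acting on bounded functions\<close>

definition drift :: "'k::finite msj \<Rightarrow> ('k list \<Rightarrow> real) \<Rightarrow> 'k list \<Rightarrow> real" where
  "drift S f u =
     (\<Sum>i\<in>UNIV. class_rate S i * (f (u @ [i]) - f u)) +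
     (\<Sum>j<num_in_service S u. service_rate S (u ! j) * (f (remove_job j u) - f u))"

text \<open>The diagonal entry \<open>- exit_rate S u\<close> is spread over the transitions as the
  terms \<open>- f u\<close>. Hence \<open>drift S f\<close> is the generator applied to
  \<open>f\<close>, written with finite sums only.\<close>

lemma has_sum_generator:
  "((\<lambda>v. generator S u v * f v) has_sum drift S f u) UNIV"
proof -
  have 1: "((\<lambda>v. (if v = u then - exit_rate S u else 0) * f v) has_sum - exit_rate S u * f u) UNIV"
    by (rule has_sum_finite_neutralI[of "{u}"]) auto
  have "(\<lambda>v. generator S u v * f v) =
      (\<lambda>v. trans_rate S u v * f v + (if v = u then - exit_rate S u else 0) * f v)"
    by (auto simp: generator_def trans_rate_self)
  moreover have "drift S f u = ((\<Sum>i\<in>UNIV. class_rate S i * f (u @ [i])) +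
     (\<Sum>j<num_in_service S u. service_rate S (u ! j) * f (remove_job j u))) + - exit_rate S u * f u"
    by (simp add: drift_def exit_rate_eq algebra_simps sum_subtractf sum_distrib_left)
  ultimately show ?thesis
    using has_sum_add[OF has_sum_trans_rate 1] by simp
qed

lemma abs_drift_le:
  assumes "msj_system S" "\<And>u. \<bar>f u\<bar> \<le> B"
  shows "\<bar>drift S f u\<bar> \<le> exit_rate S u * (2 * B)"
proof -
  have *: "\<bar>f v - f u\<bar> \<le> 2 * B" for v using assms(2)[of v] assms(2)[of u] by linarith
  have **: "\<bar>c * (f v - f u)\<bar> \<le> c * (2 * B)" if "c \<ge> 0" for c v
    using * that by (simp add: abs_mult mult_left_mono)
  have "\<bar>drift S f u\<bar> \<le> (\<Sum>i\<in>UNIV. \<bar>class_rate S i * (f (u @ [i]) - f u)\<bar>) +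
     (\<Sum>j<num_in_service S u. \<bar>service_rate S (u ! j) * (f (remove_job j u) - f u)\<bar>)"
    unfolding drift_def by (intro abs_triangle_ineq[THEN order_trans] add_mono sum_abs)
  also have "\<dots> \<le> (\<Sum>i\<in>UNIV. class_rate S i * (2 * B)) +
     (\<Sum>j<num_in_service S u. service_rate S (u ! j) * (2 * B))"
    by (intro add_mono sum_mono **)
      (use assms(1) class_rate_pos[OF assms(1)] in \<open>auto simp: msj_system_def less_imp_le\<close>)
  finally show ?thesis by (simp add: exit_rate_eq sum_distrib_right distrib_right)
qed

text \<open>This is \<open>(\<pi> Q) f = \<pi> (Q f)\<close>: since the rates and \<open>f\<close>
  are bounded, the double sum converges absolutely and its order may be exchanged.\<close>

lemma expectation_drift:
  assumes S: "msj_system S" and st: "stationary_distribution S \<pi>"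
    and f: "\<And>u. \<bar>f u\<bar> \<le> B"
  shows "measure_pmf.expectation \<pi> (drift S f) = 0"
proof -
  obtain C where C: "\<And>u. \<bar>exit_rate S u\<bar> \<le> C" using exit_rate_bounded[OF S] by blast
  have B: "B \<ge> 0" using f[of "[]"] by linarith
  \<comment> \<open>Dominates \<open>\<bar>generator S u v * f v\<bar>\<close>. The jumps and the
    diagonal each contribute \<open>exit_rate S u * B\<close> to the row sum, hence the factor 2
    below.\<close>
  define a where "a u v = (trans_rate S u v + (if v = u then exit_rate S u else 0)) * B" for u v
  have e0: "exit_rate S u \<ge> 0" for u
    unfolding exit_rate_eq using S class_rate_pos[OF S]
    by (intro add_nonneg_nonneg sum_nonneg) (auto simp: msj_system_def less_imp_le)
  have sum_a: "((\<lambda>v. pmf \<pi> u * a u v) has_sum (pmf \<pi> u * (2 * exit_rate S u * B))) UNIV" for u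
  proof -
    have 1: "((\<lambda>v. (if v = u then exit_rate S u else 0) * B) has_sum exit_rate S u * B) UNIV"
      by (rule has_sum_finite_neutralI[of "{u}"]) auto
    have "((\<lambda>v. a u v) has_sum (2 * exit_rate S u * B)) UNIV"
      using has_sum_add[OF has_sum_trans_rate[of S u "\<lambda>_. B"] 1]
      unfolding a_def exit_rate_eq sum_distrib_right[symmetric] distrib_right by (simp add: algebra_simps)
    then show ?thesis by (rule has_sum_cmult_right)
  qed
  have "\<bar>2 * exit_rate S u * B\<bar> \<le> 2 * C * B" for u
    using C[of u] B by (simp add: abs_mult mult_right_mono)
  from has_sum_pmf_times_bounded[OF this, of \<pi>]
  have "(\<lambda>u. pmf \<pi> u * (2 * exit_rate S u * B)) summable_on UNIV"
    by (rule has_sum_imp_summable)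
  then have "(\<lambda>(u, v). pmf \<pi> u * a u v) summable_on UNIV \<times> UNIV"
    using sum_a by (intro summable_on_SigmaI[where g = "\<lambda>u. pmf \<pi> u * (2 * exit_rate S u * B)"])
      (auto simp: a_def B e0 trans_rate_nonneg[OF S])
  moreover have "norm (pmf \<pi> u * (generator S u v * f v)) \<le> pmf \<pi> u * a u v" for u v
  proof -
    have "\<bar>generator S u v\<bar> \<le> trans_rate S u v + (if v = u then exit_rate S u else 0)"
      using e0[of u] trans_rate_nonneg[OF S] by (auto simp: generator_def)
    then have "\<bar>generator S u v\<bar> * \<bar>f v\<bar> \<le> a u v"
      unfolding a_def using f[of v] by (intro mult_mono) auto
    then show ?thesis by (simp add: abs_mult mult_left_mono)
  qed
  ultimately have "(\<lambda>x. norm (case x of (u, v) \<Rightarrow> pmf \<pi> u * (generator S u v * f v))) summable_on UNIV \<times> UNIV"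
    by (intro Infinite_Sum.abs_summable_on_comparison_test'[of "\<lambda>(u, v). pmf \<pi> u * a u v"])
      (simp_all add: case_prod_beta)
  then have "(\<lambda>(u, v). pmf \<pi> u * (generator S u v * f v)) summable_on UNIV \<times> UNIV"
    by (rule abs_summable_summable)
  \<comment> \<open>Summing over \<open>v\<close> first yields the drift; summing over
    \<open>u\<close> first yields the stationarity equation at \<open>v\<close> times
    \<open>f v\<close>, which is zero.\<close>
  from infsum_swap_banach[OF this]
  have "(\<Sum>\<^sub>\<infinity>u. pmf \<pi> u * drift S f u) = (\<Sum>\<^sub>\<infinity>v. \<Sum>\<^sub>\<infinity>u. pmf \<pi> u * (generator S u v * f v))"
    using infsumI[OF has_sum_cmult_right[OF has_sum_generator[of S _ f]]] by simp
  moreover have "(\<Sum>\<^sub>\<infinity>u. pmf \<pi> u * (generator S u v * f v)) = 0" for v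
  proof -
    have "((\<lambda>u. pmf \<pi> u * generator S u v) has_sum 0) UNIV"
      using st by (simp add: stationary_distribution_def)
    from has_sum_cmult_left[OF this, of "f v"] show ?thesis
      by (intro infsumI) (simp add: mult.assoc)
  qed
  ultimately have "(\<Sum>\<^sub>\<infinity>u. pmf \<pi> u * drift S f u) = 0" by simp
  moreover have "\<bar>drift S f u\<bar> \<le> C * (2 * B)" for u
  proof -
    have "\<bar>drift S f u\<bar> \<le> exit_rate S u * (2 * B)" by (rule abs_drift_le[OF S f])
    also have "\<dots> \<le> C * (2 * B)" using C[of u] B by (intro mult_right_mono) auto
    finally show ?thesis .
  qed
  ultimately show ?thesis
    using infsumI[OF has_sum_pmf_times_bounded[of "drift S f" "C * (2 * B)" \<pi>]] by simp
qed


section \<open>Counting jobs and busy servers by class\<close>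

definition in_service :: "'k::finite msj \<Rightarrow> 'k \<Rightarrow> 'k list \<Rightarrow> nat" where
  "in_service S i u = count_list (take (num_in_service S u) u) i"

definition offered :: "'k::finite msj \<Rightarrow> 'k \<Rightarrow> real" where
  "offered S i = class_rate S i / service_rate S i"

definition busy :: "'k::finite msj \<Rightarrow> 'k list \<Rightarrow> nat" where
  "busy S u = (\<Sum>j<num_in_service S u. server_need S (u ! j))"

lemma in_service_le_count: "in_service S i u \<le> count_list u i"
  by (metis append_take_drop_id count_list_append in_service_def le_add1)

lemma in_service_le_servers:
  assumes "msj_system S"
  shows "in_service S i u \<le> servers S"
  using count_le_length[of "take (num_in_service S u) u" i] num_in_service_le_servers[OF assms, of u]
  unfolding in_service_def by simp

lemma sum_nth_take:
  fixes m :: "'k::finite \<Rightarrow> nat"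
  assumes "k \<le> length u"
  shows "(\<Sum>j<k. m (u ! j)) = (\<Sum>i\<in>UNIV. m i * count_list (take k u) i)"
  using assms
proof (induction k)
  case (Suc k)
  have "(\<Sum>i\<in>UNIV. m i * count_list [u ! k] i) = (\<Sum>i\<in>UNIV. if i = u ! k then m i else 0)"
    by (rule sum.cong) auto
  then have "(\<Sum>i\<in>UNIV. m i * count_list [u ! k] i) = m (u ! k)" by simp
  with Suc show ?case
    by (simp only: take_Suc_conv_app_nth count_list_append distrib_left sum.distrib sum.lessThan_Suc)
qed simp

text \<open>Regrouping positions by class allows the estimates for single classes to be added up
  with the server needs as weights.\<close>

lemma busy_eq: "busy S u = (\<Sum>i\<in>UNIV. server_need S i * in_service S i u)"
  unfolding busy_def in_service_def by (rule sum_nth_take[OF num_in_service_le_length])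

lemma server_need_le_max: "server_need S i \<le> max_need S"
  unfolding max_need_def by (rule Max_ge) auto

text \<open>If a job were waiting, the first one in the queue would still fit, which contradicts the
  maximality of the prefix in service.\<close>

lemma queue_empty:
  assumes "busy S u + max_need S \<le> servers S"
  shows "num_in_service S u = length u"
proof (rule ccontr)
  let ?k = "num_in_service S u"
  assume "?k \<noteq> length u"
  then have k: "Suc ?k \<le> length u" using num_in_service_le_length[of S u] by simp
  have "(\<Sum>j<Suc ?k. server_need S (u ! j)) \<le> servers S"
    using assms server_need_le_max[of S "u ! ?k"] by (simp add: busy_def)
  from num_in_service_ge[OF k this] show False by simp
qed

lemma count_list_remove_job:
  assumes "j < length u"
  shows "count_list (remove_job j u) i = count_list u i - (if u ! j = i then 1 else 0)"
proof -
  have "count_list u i = count_list (take j u @ u ! j # drop (Suc j) u) i"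
    using id_take_nth_drop[OF assms] by simp
  then show ?thesis by (simp add: remove_job_def)
qed

text \<open>Only arrivals and departures of class \<open>i\<close> change its count, so the count
  moves like a birth-death process whose death rate depends on \<open>in_service\<close>. The
  truncated \<open>count_list u i - 1\<close> is harmless: at count 0 no job of the class is in
  service.\<close>

lemma drift_count:
  "drift S (\<lambda>u. F (count_list u i)) u =
     class_rate S i * (F (Suc (count_list u i)) - F (count_list u i)) +
     service_rate S i * real (in_service S i u) * (F (count_list u i - 1) - F (count_list u i))"
proof -
  let ?N = "count_list u i" and ?k = "num_in_service S u"
  have "(\<Sum>j\<in>UNIV. class_rate S j * (F (count_list (u @ [j]) i) - F ?N)) =
      (\<Sum>j\<in>UNIV. if j = i then class_rate S i * (F (Suc ?N) - F ?N) else 0)"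
    by (rule sum.cong) auto
  moreover have "(\<Sum>j<?k. service_rate S (u ! j) * (F (count_list (remove_job j u) i) - F ?N)) =
      (\<Sum>j<?k. if u ! j = i then service_rate S i * (F (?N - 1) - F ?N) else 0)"
    using num_in_service_le_length[of S u] by (intro sum.cong) (auto simp: count_list_remove_job)
  moreover have "\<dots> = (\<Sum>j\<in>{j\<in>{..<?k}. u ! j = i}. service_rate S i * (F (?N - 1) - F ?N))"
    by (rule sum.inter_filter[symmetric]) simp
  moreover have "card {j\<in>{..<?k}. u ! j = i} = in_service S i u"
    unfolding in_service_def count_list_eq_length_filter length_filter_conv_card
    using num_in_service_le_length[of S u] by (intro arg_cong[where f = card]) auto
  ultimately show ?thesis unfolding drift_def by simp
qed

section \<open>The balance equation of a single class\<close>

lemma integrable_bounded_pmf: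
  fixes g :: "'a \<Rightarrow> real"
  assumes "\<And>u. \<bar>g u\<bar> \<le> C"
  shows "integrable (measure_pmf p) g"
  by (rule measure_pmf.integrable_const_bound[where B = C]) (auto simp: assms)

text \<open>If \<open>F\<close> has the increments \<open>F n - F (n - 1) = h n\<close> for
  \<open>n \<ge> 1\<close>, then the drift of \<open>F\<close> at the class count is exactly this
  integrand.\<close>

lemma class_balance:
  fixes h :: "nat \<Rightarrow> real"
  assumes S: "msj_system S" and st: "stationary_distribution S \<pi>" and h: "\<And>n. \<bar>h n\<bar> \<le> C"
  shows "measure_pmf.expectation \<pi> (\<lambda>u. class_rate S i * h (Suc (count_list u i)) -
           service_rate S i * real (in_service S i u) * h (count_list u i)) = 0"
proof -
  \<comment> \<open>Truncation at \<open>M\<close>: the summatory function \<open>F\<close> of \<open>h\<close> need not be bounded, so it is not itself an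
    admissible test function.\<close>
  define g where "g M u = class_rate S i * (if Suc (count_list u i) \<le> M then h (Suc (count_list u i)) else 0) -
           service_rate S i * real (in_service S i u) * (if count_list u i \<le> M then h (count_list u i) else 0)"
    for M u
  have C: "C \<ge> 0" using h[of 0] by linarith
  have "measure_pmf.expectation \<pi> (g M) = 0" for M
  proof -
    define F where "F n = (\<Sum>j\<in>{1..n}. if j \<le> M then h j else 0)" for n
    have F_Suc: "F (Suc n) = F n + (if Suc n \<le> M then h (Suc n) else 0)" for n
      by (simp add: F_def)
    have "\<bar>F n\<bar> \<le> (\<Sum>j\<in>{..M}. \<bar>h j\<bar>)" for n
    proof -
      have "F n = (\<Sum>j\<in>{j\<in>{1..n}. j \<le> M}. h j)"
        unfolding F_def by (rule sum.inter_filter[symmetric]) simp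
      also have "\<bar>\<dots>\<bar> \<le> (\<Sum>j\<in>{j\<in>{1..n}. j \<le> M}. \<bar>h j\<bar>)" by (rule sum_abs)
      also have "\<dots> \<le> (\<Sum>j\<in>{..M}. \<bar>h j\<bar>)" by (rule sum_mono2) auto
      finally show ?thesis .
    qed
    then have "measure_pmf.expectation \<pi> (drift S (\<lambda>u. F (count_list u i))) = 0"
      by (rule expectation_drift[OF S st])
    moreover have "drift S (\<lambda>u. F (count_list u i)) u = g M u" for u
    \<comment> \<open>At count 0, \<open>F\<close> has no increment to the left while
      \<open>g\<close> contains \<open>h 0\<close>; that term vanishes because its factor
      \<open>in_service S i u\<close> is 0.\<close>
    proof (cases "count_list u i")
      case 0
      then show ?thesis
        using in_service_le_count[of S i u] by (simp add: drift_count g_def F_Suc)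
    next
      case (Suc n)
      then show ?thesis by (simp add: drift_count g_def F_Suc)
    qed
    ultimately show ?thesis by (metis (no_types, lifting) ext)
  qed
  moreover have "(\<lambda>M. measure_pmf.expectation \<pi> (g M)) \<longlonglongrightarrow>
      measure_pmf.expectation \<pi> (\<lambda>u. class_rate S i * h (Suc (count_list u i)) -
           service_rate S i * real (in_service S i u) * h (count_list u i))"
  \<comment> \<open>For each state the integrand is constant in \<open>M\<close> once
    \<open>M\<close> exceeds the class count; the bound uniform in \<open>M\<close> uses that at
    most \<open>servers S\<close> jobs are in service.\<close>
  proof (rule integral_dominated_convergence
      [where w = "\<lambda>_. class_rate S i * C + service_rate S i * real (servers S) * C"])
    show "AE u in measure_pmf \<pi>. (\<lambda>M. g M u) \<longlonglongrightarrow> class_rate S i * h (Suc (count_list u i)) -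
           service_rate S i * real (in_service S i u) * h (count_list u i)"
    proof (intro AE_I2 tendsto_eventually)
      fix u
      show "\<forall>\<^sub>F M in sequentially. g M u = class_rate S i * h (Suc (count_list u i)) -
           service_rate S i * real (in_service S i u) * h (count_list u i)"
        using eventually_ge_at_top[of "Suc (count_list u i)"] by eventually_elim (simp add: g_def)
    qed
    show "AE u in measure_pmf \<pi>. norm (g M u) \<le> class_rate S i * C + service_rate S i * real (servers S) * C" for M
    proof (intro AE_I2)
      fix u
      have pos: "class_rate S i \<ge> 0" "service_rate S i \<ge> 0"
        using class_rate_pos[OF S, of i] S by (auto simp: msj_system_def less_imp_le)
      have "\<bar>class_rate S i * (if Suc (count_list u i) \<le> M then h (Suc (count_list u i)) else 0)\<bar> \<le> class_rate S i * C"
        using pos C h by (auto simp: abs_mult intro!: mult_left_mono)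
      moreover have "\<bar>service_rate S i * real (in_service S i u) * (if count_list u i \<le> M then h (count_list u i) else 0)\<bar>
          \<le> service_rate S i * real (servers S) * C"
        unfolding abs_mult using pos C h in_service_le_servers[OF S, of i u]
        by (intro mult_mono) auto
      ultimately show "norm (g M u) \<le> class_rate S i * C + service_rate S i * real (servers S) * C"
        unfolding g_def real_norm_def by linarith
    qed
  qed auto
  ultimately show ?thesis by (simp add: LIMSEQ_const_iff)
qed

section \<open>The ramp test function and its expectation\<close>

definition ramp :: "real \<Rightarrow> real \<Rightarrow> real" where
  "ramp r x = max 0 (min 1 ((x - r) / sqrt r))"

lemma ramp_bounds: "0 \<le> ramp r x" "ramp r x \<le> 1"
  by (auto simp: ramp_def)

text \<open>The slope is \<open>1 / sqrt r\<close>. A ramp of width \<open>w\<close> costs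
  \<open>r / w\<close> in the balance equation and \<open>w\<close> in the pointwise lower bound;
  \<open>w = sqrt r\<close> minimizes the sum.\<close>

lemma ramp_step:
  assumes "r > 0"
  shows "ramp r (x + 1) - ramp r x \<le> 1 / sqrt r"
proof -
  have "(x + 1 - r) / sqrt r = (x - r) / sqrt r + 1 / sqrt r"
    by (simp add: add_divide_distrib diff_divide_distrib)
  moreover have "1 / sqrt r > 0" using assms by simp
  ultimately show ?thesis unfolding ramp_def by linarith
qed

lemma mult_ramp_nonneg:
  assumes "r > 0"
  shows "(x - r) * ramp r x \<ge> 0"
proof (cases "x \<ge> r")
  case False
  then have "(x - r) / sqrt r \<le> 0" using assms by (simp add: divide_nonpos_pos)
  then show ?thesis by (simp add: ramp_def)
qed (simp add: ramp_bounds)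

lemma mult_ramp_ge:
  assumes "r > 0" "z \<le> x"
  shows "(z - r) * ramp r x \<ge> z - r - sqrt r"
proof (cases "x \<ge> r + sqrt r")
  case True
  then have "(x - r) / sqrt r \<ge> 1" using assms by simp
  then show ?thesis using assms by (simp add: ramp_def)
next
  case False
  \<comment> \<open>The claim in complementary form: on this branch
    \<open>z \<le> x < r + sqrt r\<close>, so even the full excess \<open>z - r\<close> is below
    \<open>sqrt r\<close>.\<close>
  have "(z - r) * (1 - ramp r x) \<le> sqrt r"
  proof (cases "z \<ge> r")
    case True
    then have "(z - r) * (1 - ramp r x) \<le> (z - r) * 1"
      using ramp_bounds by (intro mult_left_mono) auto
    then show ?thesis using False assms by simp
  next
    case False
    then have "(z - r) * (1 - ramp r x) \<le> 0"
      using ramp_bounds[of r x] by (intro mult_nonpos_nonneg) auto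
    then show ?thesis using assms(1) real_sqrt_gt_zero[of r] by linarith
  qed
  then show ?thesis by (simp add: algebra_simps)
qed

lemma offered_pos: "msj_system S \<Longrightarrow> offered S i > 0"
  using class_rate_pos[of S i] by (auto simp: offered_def msj_system_def)

lemma abs_ramp_term_le:
  assumes "msj_system S"
  shows "\<bar>(real (in_service S i u) - offered S i) * ramp (offered S i) x\<bar> \<le> real (servers S) + offered S i"
proof -
  have "\<bar>real (in_service S i u) - offered S i\<bar> \<le> real (servers S) + offered S i"
    using in_service_le_servers[OF assms, of i u] offered_pos[OF assms, of i] by linarith
  then have "\<bar>real (in_service S i u) - offered S i\<bar> * \<bar>ramp (offered S i) x\<bar>
      \<le> (real (servers S) + offered S i) * 1"
    using ramp_bounds[of "offered S i" x] by (intro mult_mono) auto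
  then show ?thesis by (simp add: abs_mult)
qed

lemma expectation_ramp_le:
  assumes S: "msj_system S" and st: "stationary_distribution S \<pi>"
  shows "measure_pmf.expectation \<pi> (\<lambda>u. (real (in_service S i u) - offered S i) *
           ramp (offered S i) (real (count_list u i))) \<le> sqrt (offered S i)"
proof -
  let ?r = "offered S i" and ?\<mu> = "service_rate S i"
  let ?h = "\<lambda>n. ramp ?r (real n)"
  let ?N = "\<lambda>u. count_list u i"
  have r: "?r > 0" by (rule offered_pos[OF S])
  have \<mu>: "?\<mu> > 0" using S by (simp add: msj_system_def)
  have lam: "class_rate S i = ?\<mu> * ?r" using \<mu> by (simp add: offered_def)
  have int: "integrable (measure_pmf \<pi>) (\<lambda>u. (real (in_service S i u) - ?r) * ?h (?N u))"
    by (rule integrable_bounded_pmf) (rule abs_ramp_term_le[OF S])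
  have h1: "\<bar>?h n\<bar> \<le> 1" for n using ramp_bounds[of ?r "real n"] by simp
  have int2: "integrable (measure_pmf \<pi>) (\<lambda>u. ?h (Suc (?N u)) - ?h (?N u))"
    by (intro Bochner_Integration.integrable_diff integrable_bounded_pmf[where C = 1] h1)
  have "0 = measure_pmf.expectation \<pi> (\<lambda>u. class_rate S i * ?h (Suc (?N u)) -
           ?\<mu> * real (in_service S i u) * ?h (?N u))"
    by (rule class_balance[OF S st h1, symmetric])
  \<comment> \<open>With the arrival rate written as \<open>?\<mu> * ?r\<close>, subtracting and
    adding \<open>?r * ?h (?N u)\<close> separates the increment of the ramp from the centred number
    in service.\<close>
  also have "(\<lambda>u. class_rate S i * ?h (Suc (?N u)) - ?\<mu> * real (in_service S i u) * ?h (?N u)) =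
      (\<lambda>u. ?\<mu> * (?r * (?h (Suc (?N u)) - ?h (?N u)) - (real (in_service S i u) - ?r) * ?h (?N u)))"
    unfolding lam by (simp add: algebra_simps)
  also have "measure_pmf.expectation \<pi> \<dots> = ?\<mu> * (?r * measure_pmf.expectation \<pi> (\<lambda>u. ?h (Suc (?N u)) - ?h (?N u)) -
      measure_pmf.expectation \<pi> (\<lambda>u. (real (in_service S i u) - ?r) * ?h (?N u)))"
    using int int2 by simp
  finally have "measure_pmf.expectation \<pi> (\<lambda>u. (real (in_service S i u) - ?r) * ?h (?N u)) =
      ?r * measure_pmf.expectation \<pi> (\<lambda>u. ?h (Suc (?N u)) - ?h (?N u))"
    using \<mu> by simp
  also have "\<dots> \<le> ?r * (1 / sqrt ?r)"
  proof (intro mult_left_mono)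
    have "measure_pmf.expectation \<pi> (\<lambda>u. ?h (Suc (?N u)) - ?h (?N u)) \<le>
        measure_pmf.expectation \<pi> (\<lambda>u. 1 / sqrt ?r)"
      using int2 ramp_step[OF r] by (intro integral_mono) (simp_all add: add.commute[of 1])
    then show "measure_pmf.expectation \<pi> (\<lambda>u. ?h (Suc (?N u)) - ?h (?N u)) \<le> 1 / sqrt ?r" by simp
  qed (use r in auto)
  also have "\<dots> = sqrt ?r" using r by (simp add: real_div_sqrt)
  finally show ?thesis .
qed

section \<open>From queueing to busy servers, and the probability that many are busy\<close>

lemma sum_need_offered:
  assumes "msj_system S"
  shows "(\<Sum>i\<in>UNIV. real (server_need S i) * offered S i) = real (servers S) * load S"
proof -
  have "servers S > 0" using assms by (auto simp: msj_system_def intro: Suc_le_lessD order_trans)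
  then show ?thesis
    unfolding load_def offered_def sum_distrib_left by (intro sum.cong) (auto simp: field_simps)
qed

text \<open>With at least \<open>max_need S\<close> servers idle, the queue is empty and a job of
  any class fits. The resulting event depends on the state alone, so the class of the arrival is
  projected away.\<close>

lemma queueing_prob_le_busy:
  "queueing_prob S \<pi> \<le> measure_pmf.prob \<pi> {u. servers S < busy S u + max_need S}"
proof -
  have blocked: "servers S < busy S u + max_need S"
    if "queue S u \<noteq> [] \<or> idle_servers S u < server_need S i" for u i
  proof (rule ccontr)
    assume *: "\<not> servers S < busy S u + max_need S"
    then have "queue S u = []" using queue_empty[of S u] by (simp add: queue_def)
    moreover have "idle_servers S u \<ge> server_need S i"
      using * server_need_le_max[of S i] by (simp add: idle_servers_def busy_def[symmetric])
    ultimately show False using that by simp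
  qed
  have "queueing_prob S \<pi> \<le> measure_pmf.prob (pair_pmf \<pi> (class_dist S))
       (fst -` {u. servers S < busy S u + max_need S})"
    unfolding queueing_prob_def
  proof (rule measure_pmf.finite_measure_mono)
    show "{(u, i). queue S u \<noteq> [] \<or> idle_servers S u < server_need S i} \<subseteq>
        fst -` {u. servers S < busy S u + max_need S}"
    proof (rule subsetI)
      fix x
      assume "x \<in> {(u, i). queue S u \<noteq> [] \<or> idle_servers S u < server_need S i}"
      then show "x \<in> fst -` {u. servers S < busy S u + max_need S}"
        using blocked[of "fst x" "snd x"] by (simp add: case_prod_beta)
    qed
  qed simp
  also have "\<dots> = measure_pmf.prob (map_pmf fst (pair_pmf \<pi> (class_dist S))) {u. servers S < busy S u + max_need S}"
    by simp
  finally show ?thesis by (simp only: map_fst_pair_pmf)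
qed

text \<open>The weighted sum of the ramp terms is bounded below pointwise and above in expectation.
  The \<open>D\<close> on the left is the loss in the pointwise bound, the \<open>D\<close> on the
  right the bound from \<open>expectation_ramp_le\<close>.\<close>

lemma prob_busy_le:
  assumes S: "msj_system S" and st: "stationary_distribution S \<pi>"
  defines "P \<equiv> measure_pmf.prob \<pi> {u. servers S < busy S u + max_need S}"
  defines "D \<equiv> \<Sum>i\<in>UNIV. real (server_need S i) * sqrt (offered S i)"
  shows "P * (real (servers S) * (1 - load S) - real (max_need S) - D) \<le> D"
proof -
  let ?A = "{u. servers S < busy S u + max_need S}"
  let ?c = "real (servers S) * (1 - load S) - real (max_need S) - D"
  let ?t = "\<lambda>i u. (real (in_service S i u) - offered S i) * ramp (offered S i) (real (count_list u i))"
  let ?G = "\<lambda>u. \<Sum>i\<in>UNIV. real (server_need S i) * ?t i u"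
  have int: "integrable (measure_pmf \<pi>) (?t i)" for i
    by (rule integrable_bounded_pmf) (rule abs_ramp_term_le[OF S])
  have le: "indicator ?A u * ?c \<le> ?G u" for u
  proof (cases "u \<in> ?A")
    case True
    have "?c \<le> real (busy S u) - real (servers S) * load S - D"
      using True by (simp add: algebra_simps)
    also have "\<dots> = (\<Sum>i\<in>UNIV. real (server_need S i) *
        (real (in_service S i u) - offered S i - sqrt (offered S i)))"
      by (simp add: busy_eq D_def sum_need_offered[OF S, symmetric] right_diff_distrib sum_subtractf)
    also have "\<dots> \<le> ?G u"
      using offered_pos[OF S] in_service_le_count
      by (intro sum_mono mult_left_mono mult_ramp_ge) auto
    finally show ?thesis using True by simp
  next
    case False
    then have "num_in_service S u = length u" using queue_empty[of S u] by simp
    then have "in_service S i u = count_list u i" for i by (simp add: in_service_def)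
    then have "?G u \<ge> 0"
      using offered_pos[OF S] by (auto intro!: sum_nonneg mult_nonneg_nonneg mult_ramp_nonneg)
    then show ?thesis using False by simp
  qed
  have intA: "integrable (measure_pmf \<pi>) (indicat_real ?A)"
    by (rule integrable_bounded_pmf[where C = 1]) (simp add: indicator_def)
  then have "P * ?c = measure_pmf.expectation \<pi> (\<lambda>u. indicator ?A u * ?c)"
    by (simp add: P_def)
  also have "\<dots> \<le> measure_pmf.expectation \<pi> ?G"
    by (intro integral_mono le) (intro integrable_mult_left intA Bochner_Integration.integrable_sum integrable_mult_right int)+
  also have "\<dots> = (\<Sum>i\<in>UNIV. real (server_need S i) * measure_pmf.expectation \<pi> (?t i))"
    using int by (simp add: Bochner_Integration.integral_sum)
  also have "\<dots> \<le> D"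
    unfolding D_def by (intro sum_mono mult_left_mono expectation_ramp_le[OF S st]) auto
  finally show ?thesis .
qed

text \<open>The work offered by one class is at most the total \<open>servers S * load S\<close>, so
  the square of the left-hand side, one factor \<open>server_need S i\<close> times this work, is at
  most \<open>max_need S * servers S\<close>.\<close>

lemma need_sqrt_offered_le:
  assumes S: "msj_system S" and load: "load S \<le> 1"
  shows "real (server_need S i) * sqrt (offered S i) \<le> sqrt (real (max_need S) * real (servers S))"
proof -
  let ?m = "real (server_need S i)"
  have "?m * offered S i \<le> (\<Sum>i\<in>UNIV. real (server_need S i) * offered S i)"
    by (rule member_le_sum) (use offered_pos[OF S] in \<open>auto simp: less_imp_le\<close>)
  also have "\<dots> \<le> real (servers S)"
    using load by (simp add: sum_need_offered[OF S] mult_left_le)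
  finally have "?m * (?m * offered S i) \<le> real (max_need S) * real (servers S)"
    using server_need_le_max[of S i] offered_pos[OF S, of i] by (intro mult_mono) auto
  then have "sqrt (?m * (?m * offered S i)) \<le> sqrt (real (max_need S) * real (servers S))"
    by (rule real_sqrt_le_mono)
  then show ?thesis by (simp add: real_sqrt_mult flip: mult.assoc)
qed

section \<open>The explicit bound and the limit\<close>

lemma queueing_prob_le:
  fixes S :: "'k::finite msj"
  assumes S: "msj_system S" and st: "stationary_distribution S \<pi>"
    and load: "load S < 1 - real (max_need S) / real (servers S)"
  shows "queueing_prob S \<pi> \<le> 1 / (1 - load S) *
     (2 * real CARD('k) * sqrt (real (max_need S) / real (servers S)) + real (max_need S) / real (servers S))"
proof -
  let ?n = "real (servers S)" and ?m = "real (max_need S)"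
  define P where "P = measure_pmf.prob \<pi> {u. servers S < busy S u + max_need S}"
  define D where "D = (\<Sum>i\<in>UNIV. real (server_need S i) * sqrt (offered S i))"
  have n: "?n > 0" using S by (auto simp: msj_system_def intro: Suc_le_lessD order_trans)
  have l1: "load S < 1" using load by (smt (verit) divide_nonneg_nonneg of_nat_0_le_iff)
  have D0: "D \<ge> 0"
    unfolding D_def using offered_pos[OF S] by (auto intro!: sum_nonneg simp: less_imp_le)
  have "D \<le> (\<Sum>i\<in>(UNIV :: 'k set). sqrt (?m * ?n))"
    unfolding D_def using l1 by (intro sum_mono need_sqrt_offered_le[OF S]) auto
  then have D: "D \<le> real CARD('k) * sqrt (?m * ?n)" by simp
  have P: "0 \<le> P" "P \<le> 1" by (simp_all add: P_def)
  have "P * (?n * (1 - load S)) - P * (?m + D) \<le> D"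
    using prob_busy_le[OF S st] by (simp add: P_def D_def algebra_simps)
  \<comment> \<open>Only here is \<open>P \<le> 1\<close> used: it moves \<open>?m + D\<close> to
    the right-hand side, where the second \<open>D\<close> makes the constant 2.\<close>
  moreover have "P * (?m + D) \<le> ?m + D" using P D0 by (intro mult_left_le_one_le) auto
  ultimately have "P * (?n * (1 - load S)) \<le> 2 * real CARD('k) * sqrt (?m * ?n) + ?m"
    using D by linarith
  then have "P \<le> (2 * real CARD('k) * sqrt (?m * ?n) + ?m) / (?n * (1 - load S))"
    using n l1 by (simp add: pos_le_divide_eq)
  also have "\<dots> = 1 / (1 - load S) * (2 * real CARD('k) * (sqrt (?m * ?n) / ?n) + ?m / ?n)"
    using n l1 by (simp add: divide_simps)
  also have "sqrt (?m * ?n) / ?n = sqrt (?m / ?n)"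
    using n by (simp add: real_sqrt_mult real_sqrt_divide field_simps)
  finally show ?thesis
    using queueing_prob_le_busy[of S \<pi>] unfolding P_def by linarith
qed

theorem theorem4p2:
  "(\<forall>(S :: 'k::finite msj) \<pi>.
      msj_system S \<longrightarrow>
      load S < 1 - real (max_need S) / real (servers S) \<longrightarrow>
      stationary_distribution S \<pi> \<longrightarrow>
      queueing_prob S \<pi> \<le>
        1 / (1 - load S) *
          (3 * real CARD('k) * sqrt (real (max_need S) / real (servers S))
             + real (max_need S) / real (servers S)))
   \<and>
   (\<forall>(S :: nat \<Rightarrow> 'k msj) \<pi> \<mu>.
      (\<forall>\<^sub>F n in sequentially.
         msj_system (S n) \<and> servers (S n) = n \<and> service_rate (S n) = \<mu> \<and>
         load (S n) < 1 - real (max_need (S n)) / real n \<and>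
         stationary_distribution (S n) (\<pi> n)) \<longrightarrow>
      (\<lambda>n. 1 / (1 - load (S n)) * sqrt (real (max_need (S n)) / real n)) \<longlonglongrightarrow> 0 \<longrightarrow>
      (\<lambda>n. queueing_prob (S n) (\<pi> n)) \<longlonglongrightarrow> 0)"
proof (intro conjI allI impI)
  fix S :: "'k msj" and \<pi>
  assume S: "msj_system S" and load: "load S < 1 - real (max_need S) / real (servers S)"
    and st: "stationary_distribution S \<pi>"
  have l1: "load S < 1" using load by (smt (verit) divide_nonneg_nonneg of_nat_0_le_iff)
  note queueing_prob_le[OF S st load]
  also have "1 / (1 - load S) *
     (2 * real CARD('k) * sqrt (real (max_need S) / real (servers S)) + real (max_need S) / real (servers S)) \<le>
     1 / (1 - load S) *
     (3 * real CARD('k) * sqrt (real (max_need S) / real (servers S)) + real (max_need S) / real (servers S))"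
    using l1 by (intro mult_left_mono add_right_mono mult_right_mono) auto
  finally show "queueing_prob S \<pi> \<le> 1 / (1 - load S) *
     (3 * real CARD('k) * sqrt (real (max_need S) / real (servers S)) + real (max_need S) / real (servers S))" .
next
  fix S :: "nat \<Rightarrow> 'k msj" and \<pi> \<mu>
  let ?s = "\<lambda>n. sqrt (real (max_need (S n)) / real n)"
  assume ev: "\<forall>\<^sub>F n in sequentially.
         msj_system (S n) \<and> servers (S n) = n \<and> service_rate (S n) = \<mu> \<and>
         load (S n) < 1 - real (max_need (S n)) / real n \<and>
         stationary_distribution (S n) (\<pi> n)"
    and lim: "(\<lambda>n. 1 / (1 - load (S n)) * ?s n) \<longlonglongrightarrow> 0"
  have ub: "\<forall>\<^sub>F n in sequentially. queueing_prob (S n) (\<pi> n) \<le>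
      (2 * real CARD('k) + 1) * (1 / (1 - load (S n)) * ?s n)"
    using ev
  proof eventually_elim
    case (elim n)
    let ?x = "real (max_need (S n)) / real n"
    have l1: "load (S n) < 1" using elim by (smt (verit) divide_nonneg_nonneg of_nat_0_le_iff)
    have n: "n > 0" using elim by (auto simp: msj_system_def intro: Suc_le_lessD order_trans)
    have "max_need (S n) \<le> n"
      using elim by (auto simp: max_need_def msj_system_def)
    then have "0 \<le> ?x" "?x \<le> 1" using n by simp_all
    \<comment> \<open>As \<open>?x\<close> lies in \<open>[0, 1]\<close>, it is at most its square
      root, so the additive term of the bound is absorbed into the square root term.\<close>
    then have "?x \<le> ?s n" by (intro real_le_rsqrt) (simp only: power2_eq_square mult_left_le)
    then have "1 / (1 - load (S n)) * (2 * real CARD('k) * ?s n + ?x) \<le>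
        1 / (1 - load (S n)) * (2 * real CARD('k) * ?s n + ?s n)"
      using l1 by (intro mult_left_mono) auto
    also have "\<dots> = (2 * real CARD('k) + 1) * (1 / (1 - load (S n)) * ?s n)"
      by (simp add: algebra_simps add_divide_distrib)
    finally show ?case
      using queueing_prob_le[of "S n" "\<pi> n"] elim by simp
  qed
  have lim0: "(\<lambda>n. (2 * real CARD('k) + 1) * (1 / (1 - load (S n)) * ?s n)) \<longlonglongrightarrow> 0"
    using tendsto_mult_right_zero[OF lim] by blast
  have lb: "\<forall>\<^sub>F n in sequentially. 0 \<le> queueing_prob (S n) (\<pi> n)"
    by (simp add: queueing_prob_def)
  show "(\<lambda>n. queueing_prob (S n) (\<pi> n)) \<longlonglongrightarrow> 0"
    by (rule tendsto_sandwich[OF lb ub tendsto_const lim0])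
qed

end
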